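(* Let $A$ be an ordered semiring. Then there exists a canonical homeomorphism $\mathrm{pt}(\mathrm{Rad}(A))\cong\mathrm{Spec}(A)$.
   Context: Semirings are commutative and unital: $(A,0,+)$ and $(A,1,\cdot)$ are commutative monoids with $x\cdot 0=0$ and $x\cdot(y+z)=x\cdot y+x\cdot z$. An ordered semiring is a tuple $(A,\leq,0,1,+,\cdot)$ where $(A,0,1,+,\cdot)$ is a semiring and $\leq$ is a preorder on $A$ with respect to which $+$ and $\cdot$ are monotone. A subadditive morphism $f\colon A\to B$ between ordered semirings is a monotone function with $f(0_A)\leq 0_B$, $f(1_A)=1_B$, $f(x+y)\leq f(x)+f(y)$ and $f(xy)=f(x)f(y)$ for all $x,y\in A$. $\mathbf{2}=(\{0,1\},\leq,0,1,\vee,\wedge)$ is the two-element chain, regarded as an ordered semiring and also as a frame. An ideal of an ordered semiring $A$ is a subset $I\subseteq A$ such that: $x\leq y$ and $y\in I$ imply $x\in I$; $0\in I$; $x,y\in I$ implies $x+y\in I$; and if $x\in I$ or $y\in I$ then $xy\in I$. An ideal $I$ is radical if for all $x\in A$ and $n\in\mathbb{N}$, $x^n\in I$ implies $x\in I$. $\mathrm{Rad}(A)$ is the set of all radical ideals of $A$ ordered by inclusion; it is a frame (a complete lattice in which binary meets distribute over arbitrary joins). Frame homomorphisms are functions between frames preserving arbitrary joins and finite meets. A prime ideal of $A$ is an ideal $I$ with $1\notin I$ such that $xy\in I$ implies $x\in I$ or $y\in I$. $\mathrm{Spec}(A)$ is the set of prime ideals of $A$, identified with the set of subadditive morphisms $f\colon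 A\to\mathbf{2}$ via $f\mapsto f^{-1}(0)$, and given the subspace topology from the product $\mathbf{2}^A$, where $\mathbf{2}$ is the Sierpiński space in which $\{1\}$ is open; explicitly, the sets $D_x=\{f\in\mathrm{Spec}(A)\mid f(x)=1\}$ ($x\in A$) form a basis of the topology. For a frame $F$, $\mathrm{pt}(F)$ is the set of frame homomorphisms $F\to\mathbf{2}$ with the subspace topology from $\mathbf{2}^F$ ($\mathbf{2}$ again the Sierpiński space with $\{1\}$ open). *)

theory Defs
  imports "HOL-Algebra.Ring" "HOL-Algebra.Complete_Lattice" "HOL-Analysis.Function_Topology"
begin

section \<open>Ordered semirings, their ideals and morphisms\<close>

record 'a osemiring = "'a ring" +
  leq :: "'a \<Rightarrow> 'a \<Rightarrow> bool" (infixl \<open>\<preceq>\<index>\<close> 50)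

text \<open>The order is only a preorder, and the trivial semiring is allowed.\<close>

locale preordered_semiring = semiring A + comm_monoid A for A (structure) +
  assumes leq_refl: "x \<in> carrier A \<Longrightarrow> x \<preceq> x"
    and leq_trans: "\<lbrakk>x \<preceq> y; y \<preceq> z; x \<in> carrier A; y \<in> carrier A; z \<in> carrier A\<rbrakk> \<Longrightarrow> x \<preceq> z"
    and add_mono: "\<lbrakk>x \<preceq> x'; y \<preceq> y'; x \<in> carrier A; x' \<in> carrier A; y \<in> carrier A; y' \<in> carrier A\<rbrakk>
        \<Longrightarrow> x \<oplus> y \<preceq> x' \<oplus> y'"
    and mult_mono: "\<lbrakk>x \<preceq> x'; y \<preceq> y'; x \<in> carrier A; x' \<in> carrier A; y \<in> carrier A; y' \<in> carrier A\<rbrakk>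
        \<Longrightarrow> x \<otimes> y \<preceq> x' \<otimes> y'"

definition subadditive_morphism ::
    "('a, 'c) osemiring_scheme \<Rightarrow> ('b, 'd) osemiring_scheme \<Rightarrow> ('a \<Rightarrow> 'b) \<Rightarrow> bool" where
  "subadditive_morphism A B f \<longleftrightarrow>
     f \<in> carrier A \<rightarrow>\<^sub>E carrier B \<and>
     (\<forall>x\<in>carrier A. \<forall>y\<in>carrier A. x \<preceq>\<^bsub>A\<^esub> y \<longrightarrow> f x \<preceq>\<^bsub>B\<^esub> f y) \<and>
     f \<zero>\<^bsub>A\<^esub> \<preceq>\<^bsub>B\<^esub> \<zero>\<^bsub>B\<^esub> \<and>
     f \<one>\<^bsub>A\<^esub> = \<one>\<^bsub>B\<^esub> \<and>
     (\<forall>x\<in>carrier A. \<forall>y\<in>carrier A. f (x \<oplus>\<^bsub>A\<^esub> y) \<preceq>\<^bsub>B\<^esub> f x \<oplus>\<^bsub>B\<^esub> f y) \<and>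
     (\<forall>x\<in>carrier A. \<forall>y\<in>carrier A. f (x \<otimes>\<^bsub>A\<^esub> y) = f x \<otimes>\<^bsub>B\<^esub> f y)"

definition semiring_ideal :: "('a, 'c) osemiring_scheme \<Rightarrow> 'a set \<Rightarrow> bool" where
  "semiring_ideal A I \<longleftrightarrow>
     I \<subseteq> carrier A \<and>
     (\<forall>x\<in>carrier A. \<forall>y\<in>carrier A. x \<preceq>\<^bsub>A\<^esub> y \<and> y \<in> I \<longrightarrow> x \<in> I) \<and>
     \<zero>\<^bsub>A\<^esub> \<in> I \<and>
     (\<forall>x\<in>I. \<forall>y\<in>I. x \<oplus>\<^bsub>A\<^esub> y \<in> I) \<and>
     (\<forall>x\<in>carrier A. \<forall>y\<in>carrier A. x \<in> I \<or> y \<in> I \<longrightarrow> x \<otimes>\<^bsub>A\<^esub> y \<in> I)"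

definition radical_ideal :: "('a, 'c) osemiring_scheme \<Rightarrow> 'a set \<Rightarrow> bool" where
  "radical_ideal A I \<longleftrightarrow>
     semiring_ideal A I \<and> (\<forall>x\<in>carrier A. \<forall>n::nat. x [^]\<^bsub>A\<^esub> n \<in> I \<longrightarrow> x \<in> I)"

definition prime_ideal :: "('a, 'c) osemiring_scheme \<Rightarrow> 'a set \<Rightarrow> bool" where
  "prime_ideal A I \<longleftrightarrow>
     semiring_ideal A I \<and> \<one>\<^bsub>A\<^esub> \<notin> I \<and>
     (\<forall>x\<in>carrier A. \<forall>y\<in>carrier A. x \<otimes>\<^bsub>A\<^esub> y \<in> I \<longrightarrow> x \<in> I \<or> y \<in> I)"

text \<open>The radical ideal generated by \<open>x\<close>.  Sending \<open>x\<close> to it is the canonical map from \<open>A\<close> to the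
  frame of radical ideals of \<open>A\<close>, and the canonical map from the points of that frame to the
  spectrum of \<open>A\<close> is precomposition with it.\<close>

definition radical_closure :: "('a, 'c) osemiring_scheme \<Rightarrow> 'a \<Rightarrow> 'a set" where
  "radical_closure A x = \<Inter>{I. radical_ideal A I \<and> x \<in> I}"


section \<open>Frames\<close>

locale frame = complete_lattice L for L (structure) +
  assumes meet_Sup_distrib:
    "\<lbrakk>x \<in> carrier L; S \<subseteq> carrier L\<rbrakk> \<Longrightarrow> x \<sqinter> (\<Squnion>S) = \<Squnion>((\<lambda>y. x \<sqinter> y) ` S)"

text \<open>\<open>sup_pres\<close> includes the empty join; the empty meet is the top element.\<close>

definition frame_hom :: "('a, 'c) gorder_scheme \<Rightarrow> ('b, 'd) gorder_scheme \<Rightarrow> ('a \<Rightarrow> 'b) \<Rightarrow> bool" where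
  "frame_hom F G f \<longleftrightarrow>
     frame F \<and> frame G \<and> f \<in> carrier F \<rightarrow>\<^sub>E carrier G \<and>
     sup_pres F G f \<and> meet_pres F G f \<and> f \<top>\<^bsub>F\<^esub> = \<top>\<^bsub>G\<^esub>"

definition Rad :: "('a, 'c) osemiring_scheme \<Rightarrow> 'a set gorder" where
  "Rad A = \<lparr>carrier = {I. radical_ideal A I}, eq = (=), le = (\<subseteq>)\<rparr>"


section \<open>The two-element chain\<close>

definition two_semiring :: "bool osemiring" where
  "two_semiring = \<lparr>carrier = UNIV, mult = (\<and>), one = True, zero = False, add = (\<or>), leq = (\<le>)\<rparr>"

definition two_frame :: "bool gorder" where
  "two_frame = \<lparr>carrier = UNIV, eq = (=), le = (\<le>)\<rparr>"

definition sierpinski :: "bool topology" where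
  "sierpinski = topology (\<lambda>U. U \<in> {{}, {True}, UNIV})"

lemma openin_sierpinski: "openin sierpinski U \<longleftrightarrow> U \<in> {{}, {True}, UNIV}"
proof -
  have eq: "(U \<in> {{}, {True}, UNIV}) = (False \<in> U \<longrightarrow> U = UNIV)" for U :: "bool set"
    by (auto simp: UNIV_bool) (metis (full_types))+
  have "istopology (\<lambda>U :: bool set. False \<in> U \<longrightarrow> U = UNIV)"
    by (auto simp: istopology_def)
  then show ?thesis
    unfolding sierpinski_def eq by (simp add: topology_inverse')
qed

lemma topspace_sierpinski [simp]: "topspace sierpinski = UNIV"
  by (metis insertCI openin_sierpinski openin_subset top.extremum_uniqueI)


section \<open>The spaces of points and of prime ideals\<close>

text \<open>Functions on a carrier are extensional throughout, so that they are points of the product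
  topology.\<close>

definition pt :: "('a, 'c) gorder_scheme \<Rightarrow> ('a \<Rightarrow> bool) topology" where
  "pt F = subtopology (product_topology (\<lambda>_. sierpinski) (carrier F)) {p. frame_hom F two_frame p}"

text \<open>A prime ideal \<open>I\<close> is represented by the subadditive morphism into the two-element chain
  whose zero set is \<open>I\<close>; lemma \<open>Spec_prime_ideals\<close> below justifies this.\<close>

definition Spec :: "('a, 'c) osemiring_scheme \<Rightarrow> ('a \<Rightarrow> bool) topology" where
  "Spec A = subtopology (product_topology (\<lambda>_. sierpinski) (carrier A))
              {f. subadditive_morphism A two_semiring f}"


section \<open>Adequacy of the definitions\<close>

lemma semiring_idealD:
  assumes "semiring_ideal A I"
  shows "I \<subseteq> carrier A"
    and "\<forall>x\<in>carrier A. \<forall>y\<in>carrier A. x \<preceq>\<^bsub>A\<^esub> y \<and> y \<in> I \<longrightarrow> x \<in> I"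
    and "\<zero>\<^bsub>A\<^esub> \<in> I"
    and "\<forall>x\<in>I. \<forall>y\<in>I. x \<oplus>\<^bsub>A\<^esub> y \<in> I"
    and "\<forall>x\<in>carrier A. \<forall>y\<in>carrier A. x \<in> I \<or> y \<in> I \<longrightarrow> x \<otimes>\<^bsub>A\<^esub> y \<in> I"
  using assms unfolding semiring_ideal_def by - (elim conjE, assumption)+

lemma radical_idealD:
  assumes "radical_ideal A I"
  shows "semiring_ideal A I"
    and "\<And>x n. \<lbrakk>x \<in> carrier A; x [^]\<^bsub>A\<^esub> (n::nat) \<in> I\<rbrakk> \<Longrightarrow> x \<in> I"
  using assms unfolding radical_ideal_def by blast+

lemma topspace_pt: "topspace (pt F) = {p. frame_hom F two_frame p}"
  by (auto simp: pt_def frame_hom_def PiE_def)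

lemma topspace_Spec: "topspace (Spec A) = {f. subadditive_morphism A two_semiring f}"
  by (auto simp: Spec_def subadditive_morphism_def PiE_def)

lemma preordered_semiring_two: "preordered_semiring two_semiring"
  by unfold_locales (simp_all add: two_semiring_def le_bool_def, blast+)

lemma subadditive_morphism_two_iff:
  "subadditive_morphism A two_semiring f \<longleftrightarrow>
     f \<in> extensional (carrier A) \<and>
     (\<forall>x\<in>carrier A. \<forall>y\<in>carrier A. x \<preceq>\<^bsub>A\<^esub> y \<longrightarrow> f x \<longrightarrow> f y) \<and>
     \<not> f \<zero>\<^bsub>A\<^esub> \<and> f \<one>\<^bsub>A\<^esub> \<and>
     (\<forall>x\<in>carrier A. \<forall>y\<in>carrier A. f (x \<oplus>\<^bsub>A\<^esub> y) \<longrightarrow> f x \<or> f y) \<and>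
     (\<forall>x\<in>carrier A. \<forall>y\<in>carrier A. f (x \<otimes>\<^bsub>A\<^esub> y) \<longleftrightarrow> f x \<and> f y)"
  by (simp add: subadditive_morphism_def two_semiring_def PiE_def le_bool_def)

lemma Spec_prime_ideals:
  assumes "preordered_semiring A"
  shows "bij_betw (\<lambda>f. {x \<in> carrier A. \<not> f x}) (topspace (Spec A)) {I. prime_ideal A I}"
proof -
  interpret preordered_semiring A by fact
  show ?thesis
  proof (rule bij_betw_byWitness[where f' = "\<lambda>I. \<lambda>x\<in>carrier A. x \<notin> I"])
    show "\<forall>f\<in>topspace (Spec A). (\<lambda>x\<in>carrier A. x \<notin> {x \<in> carrier A. \<not> f x}) = f"
      by (auto simp: topspace_Spec subadditive_morphism_def fun_eq_iff PiE_def extensional_def)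
    show "\<forall>I\<in>{I. prime_ideal A I}. {x \<in> carrier A. \<not> (\<lambda>x\<in>carrier A. x \<notin> I) x} = I"
      by (auto simp: prime_ideal_def semiring_ideal_def)
    show "(\<lambda>f. {x \<in> carrier A. \<not> f x}) ` topspace (Spec A) \<subseteq> {I. prime_ideal A I}"
    proof clarify
      fix f assume "f \<in> topspace (Spec A)"
      then have f: "\<forall>x\<in>carrier A. \<forall>y\<in>carrier A. x \<preceq>\<^bsub>A\<^esub> y \<longrightarrow> f x \<longrightarrow> f y"
          "\<not> f \<zero>\<^bsub>A\<^esub>" "f \<one>\<^bsub>A\<^esub>"
          "\<forall>x\<in>carrier A. \<forall>y\<in>carrier A. f (x \<oplus>\<^bsub>A\<^esub> y) \<longrightarrow> f x \<or> f y"
          "\<forall>x\<in>carrier A. \<forall>y\<in>carrier A. f (x \<otimes>\<^bsub>A\<^esub> y) \<longleftrightarrow> f x \<and> f y"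
        unfolding topspace_Spec mem_Collect_eq subadditive_morphism_two_iff
        by - (elim conjE, assumption)+
      show "prime_ideal A {x \<in> carrier A. \<not> f x}"
        unfolding prime_ideal_def semiring_ideal_def
      proof (intro conjI)
        show "\<forall>x\<in>carrier A. \<forall>y\<in>carrier A.
            x \<preceq>\<^bsub>A\<^esub> y \<and> y \<in> {x \<in> carrier A. \<not> f x} \<longrightarrow> x \<in> {x \<in> carrier A. \<not> f x}"
          using f(1) by blast
        show "\<forall>x\<in>{x \<in> carrier A. \<not> f x}. \<forall>y\<in>{x \<in> carrier A. \<not> f x}.
            x \<oplus>\<^bsub>A\<^esub> y \<in> {x \<in> carrier A. \<not> f x}"
          using f(4) by blast
      qed (use f(2,3,5) in auto)
    qed
    show "(\<lambda>I. \<lambda>x\<in>carrier A. x \<notin> I) ` {I. prime_ideal A I} \<subseteq> topspace (Spec A)"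
    proof clarify
      fix I assume I: "prime_ideal A I"
      then have P: "\<one>\<^bsub>A\<^esub> \<notin> I"
          "\<forall>x\<in>carrier A. \<forall>y\<in>carrier A. x \<otimes>\<^bsub>A\<^esub> y \<in> I \<longrightarrow> x \<in> I \<or> y \<in> I"
        and "semiring_ideal A I"
        by (auto simp: prime_ideal_def)
      note D = semiring_idealD[OF this(3)]
      let ?f = "\<lambda>x\<in>carrier A. x \<notin> I"
      show "?f \<in> topspace (Spec A)"
        unfolding topspace_Spec mem_Collect_eq subadditive_morphism_two_iff
      proof (intro conjI)
        show "\<forall>x\<in>carrier A. \<forall>y\<in>carrier A. x \<preceq>\<^bsub>A\<^esub> y \<longrightarrow> ?f x \<longrightarrow> ?f y"
        proof (intro ballI impI)
          fix x y assume xy: "x \<in> carrier A" "y \<in> carrier A" "x \<preceq>\<^bsub>A\<^esub> y" "?f x"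
          then have "x \<notin> I" by simp
          with xy D(2) have "y \<notin> I" by blast
          with xy(2) show "?f y" by simp
        qed
        show "\<not> ?f \<zero>\<^bsub>A\<^esub>" "?f \<one>\<^bsub>A\<^esub>"
          using D(3) P(1) by simp_all
        show "\<forall>x\<in>carrier A. \<forall>y\<in>carrier A. ?f (x \<oplus>\<^bsub>A\<^esub> y) \<longrightarrow> ?f x \<or> ?f y"
          using D(4) by auto
        show "\<forall>x\<in>carrier A. \<forall>y\<in>carrier A. ?f (x \<otimes>\<^bsub>A\<^esub> y) \<longleftrightarrow> ?f x \<and> ?f y"
        proof (intro ballI)
          fix x y assume xy: "x \<in> carrier A" "y \<in> carrier A"
          then have "x \<otimes>\<^bsub>A\<^esub> y \<in> I \<longleftrightarrow> x \<in> I \<or> y \<in> I"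
            using D(5) P(2) by blast
          with xy show "?f (x \<otimes>\<^bsub>A\<^esub> y) \<longleftrightarrow> ?f x \<and> ?f y"
            by simp
        qed
      qed simp
    qed
  qed
qed

lemma greatest_Lower_Rad:
  assumes "preordered_semiring A" and "S \<subseteq> carrier (Rad A)"
  shows "greatest (Rad A) (carrier A \<inter> \<Inter>S) (Lower (Rad A) S)"
proof -
  interpret preordered_semiring A by fact
  have rad: "radical_ideal A J" if "J \<in> S" for J
    using that assms(2) by (auto simp: Rad_def)
  note D = semiring_idealD[OF radical_idealD(1)[OF rad]]
  let ?I = "carrier A \<inter> \<Inter>S"
  have I: "radical_ideal A ?I"
    unfolding radical_ideal_def semiring_ideal_def
  proof (intro conjI)
    show "\<forall>x\<in>carrier A. \<forall>y\<in>carrier A. x \<preceq>\<^bsub>A\<^esub> y \<and> y \<in> ?I \<longrightarrow> x \<in> ?I"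
    proof (intro ballI impI IntI InterI)
      fix x y J assume "x \<in> carrier A" "y \<in> carrier A" "x \<preceq>\<^bsub>A\<^esub> y \<and> y \<in> ?I" "J \<in> S"
      with D(2)[OF \<open>J \<in> S\<close>] show "x \<in> J" by blast
    qed
    show "\<zero>\<^bsub>A\<^esub> \<in> ?I"
      using D(3) by blast
    show "\<forall>x\<in>?I. \<forall>y\<in>?I. x \<oplus>\<^bsub>A\<^esub> y \<in> ?I"
    proof (intro ballI IntI InterI)
      fix x y J assume "x \<in> ?I" "y \<in> ?I" "J \<in> S"
      with D(4)[OF \<open>J \<in> S\<close>] show "x \<oplus>\<^bsub>A\<^esub> y \<in> J" by blast
    qed auto
    show "\<forall>x\<in>carrier A. \<forall>y\<in>carrier A. x \<in> ?I \<or> y \<in> ?I \<longrightarrow> x \<otimes>\<^bsub>A\<^esub> y \<in> ?I"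
    proof (intro ballI impI IntI InterI)
      fix x y J assume "x \<in> carrier A" "y \<in> carrier A" "x \<in> ?I \<or> y \<in> ?I" "J \<in> S"
      with D(5)[OF \<open>J \<in> S\<close>] show "x \<otimes>\<^bsub>A\<^esub> y \<in> J" by blast
    qed auto
    show "\<forall>x\<in>carrier A. \<forall>n::nat. x [^]\<^bsub>A\<^esub> n \<in> ?I \<longrightarrow> x \<in> ?I"
    proof (intro ballI allI impI IntI InterI)
      fix x J and n :: nat assume "x \<in> carrier A" "x [^]\<^bsub>A\<^esub> n \<in> ?I" "J \<in> S"
      with radical_idealD(2)[OF rad[OF \<open>J \<in> S\<close>]] show "x \<in> J" by blast
    qed
  qed blast
  have sub: "J \<subseteq> carrier A" if "radical_ideal A J" for J
    by (rule semiring_idealD(1)[OF radical_idealD(1)[OF that]])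
  show ?thesis
    unfolding greatest_def
  proof (intro conjI ballI)
    show "?I \<in> Lower (Rad A) S"
      using I by (simp add: Lower_def Rad_def Inf_lower le_infI2)
    fix J assume "J \<in> Lower (Rad A) S"
    then have "radical_ideal A J" and "\<forall>K\<in>S. J \<subseteq> K"
      using assms(2) by (simp_all add: Lower_def Rad_def subset_iff)
    then show "J \<sqsubseteq>\<^bsub>Rad A\<^esub> ?I"
      using sub[of J] by (simp add: Rad_def Inf_greatest)
  qed (simp add: Lower_def)
qed

lemma complete_lattice_Rad:
  assumes "preordered_semiring A"
  shows "complete_lattice (Rad A)"
proof -
  interpret P: partial_order "Rad A"
    by unfold_locales (auto simp: Rad_def)
  show ?thesis
  proof (rule P.complete_lattice_criterion1)
    show "\<exists>g. greatest (Rad A) g (carrier (Rad A))"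
      using greatest_Lower_Rad[OF assms, of "{}"] by auto
    show "\<exists>i. greatest (Rad A) i (Lower (Rad A) S)" if "S \<subseteq> carrier (Rad A)" for S
      using greatest_Lower_Rad[OF assms that] by blast
  qed
qed

lemma meet_Rad:
  assumes "preordered_semiring A" "radical_ideal A I" "radical_ideal A J"
  shows "I \<sqinter>\<^bsub>Rad A\<^esub> J = I \<inter> J"
proof -
  interpret complete_lattice "Rad A" by (rule complete_lattice_Rad) fact
  have IJ: "{I, J} \<subseteq> carrier (Rad A)"
    using assms by (simp add: Rad_def)
  have "greatest (Rad A) (\<Sqinter>\<^bsub>Rad A\<^esub>{I, J}) (Lower (Rad A) {I, J})"
    by (rule infI[OF _ IJ])
  then have "\<Sqinter>\<^bsub>Rad A\<^esub>{I, J} = carrier A \<inter> \<Inter>{I, J}"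
    using greatest_Lower_Rad[OF assms(1) IJ] unfolding greatest_def
    by (intro equalityI) (auto simp: Rad_def)
  also have "\<dots> = I \<inter> J"
    using semiring_idealD(1)[OF radical_idealD(1)[OF assms(2)]] by auto
  finally show ?thesis
    by (simp add: meet_def)
qed

lemma radical_ideal_residual:
  assumes "preordered_semiring A" "I \<subseteq> carrier A" "radical_ideal A K"
  shows "radical_ideal A {y \<in> carrier A. \<forall>x\<in>I. x \<otimes>\<^bsub>A\<^esub> y \<in> K}"
proof -
  interpret preordered_semiring A by fact
  note D = semiring_idealD[OF radical_idealD(1)[OF assms(3)]]
  have K: "K \<subseteq> carrier A"
      "\<And>x y. \<lbrakk>x \<in> carrier A; y \<in> K; x \<preceq>\<^bsub>A\<^esub> y\<rbrakk> \<Longrightarrow> x \<in> K"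
      "\<zero>\<^bsub>A\<^esub> \<in> K"
      "\<And>x y. \<lbrakk>x \<in> K; y \<in> K\<rbrakk> \<Longrightarrow> x \<oplus>\<^bsub>A\<^esub> y \<in> K"
      "\<And>x y. \<lbrakk>x \<in> carrier A; y \<in> K\<rbrakk> \<Longrightarrow> x \<otimes>\<^bsub>A\<^esub> y \<in> K"
      "\<And>x y. \<lbrakk>x \<in> K; y \<in> carrier A\<rbrakk> \<Longrightarrow> x \<otimes>\<^bsub>A\<^esub> y \<in> K"
      "\<And>x n. \<lbrakk>x \<in> carrier A; x [^]\<^bsub>A\<^esub> (n::nat) \<in> K\<rbrakk> \<Longrightarrow> x \<in> K"
    subgoal by (rule D(1))
    subgoal for x y using D(1,2) by blast
    subgoal by (rule D(3))
    subgoal using D(4) by blast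
    subgoal using D(1,5) by blast
    subgoal using D(1,5) by blast
    subgoal by (rule radical_idealD(2)[OF assms(3)])
    done
  let ?R = "{y \<in> carrier A. \<forall>x\<in>I. x \<otimes>\<^bsub>A\<^esub> y \<in> K}"
  have le: "y \<in> ?R" if "y \<in> carrier A" "z \<in> ?R" "y \<preceq>\<^bsub>A\<^esub> z" for y z
  proof -
    have "x \<otimes>\<^bsub>A\<^esub> y \<in> K" if x: "x \<in> I" for x
    proof -
      have xc: "x \<in> carrier A" using x assms(2) by blast
      show ?thesis
      proof (rule K(2))
        show "x \<otimes>\<^bsub>A\<^esub> z \<in> K" using \<open>z \<in> ?R\<close> x by blast
        show "x \<otimes>\<^bsub>A\<^esub> y \<preceq>\<^bsub>A\<^esub> x \<otimes>\<^bsub>A\<^esub> z"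
          using xc \<open>y \<in> carrier A\<close> \<open>z \<in> ?R\<close> \<open>y \<preceq>\<^bsub>A\<^esub> z\<close> by (intro mult_mono leq_refl) auto
      qed (use xc \<open>y \<in> carrier A\<close> in simp)
    qed
    with \<open>y \<in> carrier A\<close> show ?thesis by blast
  qed
  have rad: "y \<in> ?R" if y: "y \<in> carrier A" and n: "y [^]\<^bsub>A\<^esub> (n::nat) \<in> ?R" for y n
  proof -
    have "x \<otimes>\<^bsub>A\<^esub> y \<in> K" if x: "x \<in> I" for x
    proof -
      have xc: "x \<in> carrier A" using x assms(2) by blast
      have "x [^]\<^bsub>A\<^esub> n \<otimes>\<^bsub>A\<^esub> (x \<otimes>\<^bsub>A\<^esub> y [^]\<^bsub>A\<^esub> n) \<in> K"
        by (rule K(5)) (use n x xc in auto)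
      then have "(x [^]\<^bsub>A\<^esub> n \<otimes>\<^bsub>A\<^esub> (x \<otimes>\<^bsub>A\<^esub> y [^]\<^bsub>A\<^esub> n)) \<otimes>\<^bsub>A\<^esub> y \<in> K"
        using y by (rule K(6))
      also have "(x [^]\<^bsub>A\<^esub> n \<otimes>\<^bsub>A\<^esub> (x \<otimes>\<^bsub>A\<^esub> y [^]\<^bsub>A\<^esub> n)) \<otimes>\<^bsub>A\<^esub> y = (x \<otimes>\<^bsub>A\<^esub> y) [^]\<^bsub>A\<^esub> Suc n"
        using xc y by (simp add: nat_pow_distrib m_ac)
      finally show ?thesis
        by (rule K(7)[where n = "Suc n", rotated]) (use xc y in simp)
    qed
    with y show ?thesis by blast
  qed
  show ?thesis
    unfolding radical_ideal_def semiring_ideal_def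
  proof (intro conjI)
    show "?R \<subseteq> carrier A" by blast
    show "\<forall>x\<in>carrier A. \<forall>y\<in>carrier A. x \<preceq>\<^bsub>A\<^esub> y \<and> y \<in> ?R \<longrightarrow> x \<in> ?R"
      using le by blast
    show "\<zero>\<^bsub>A\<^esub> \<in> ?R"
      using assms(2) K(3) by (auto simp: subset_iff)
    show "\<forall>x\<in>?R. \<forall>y\<in>?R. x \<oplus>\<^bsub>A\<^esub> y \<in> ?R"
      using assms(2) K(4) by (auto simp: subset_iff r_distr)
    show "\<forall>x\<in>carrier A. \<forall>y\<in>carrier A. x \<in> ?R \<or> y \<in> ?R \<longrightarrow> x \<otimes>\<^bsub>A\<^esub> y \<in> ?R"
    proof (intro ballI impI)
      fix x y assume x: "x \<in> carrier A" and y: "y \<in> carrier A" and R: "x \<in> ?R \<or> y \<in> ?R"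
      have "z \<otimes>\<^bsub>A\<^esub> (x \<otimes>\<^bsub>A\<^esub> y) \<in> K" if z: "z \<in> I" for z
      proof -
        have zc: "z \<in> carrier A" using z assms(2) by blast
        have "z \<otimes>\<^bsub>A\<^esub> (x \<otimes>\<^bsub>A\<^esub> y) = (z \<otimes>\<^bsub>A\<^esub> x) \<otimes>\<^bsub>A\<^esub> y"
             "z \<otimes>\<^bsub>A\<^esub> (x \<otimes>\<^bsub>A\<^esub> y) = x \<otimes>\<^bsub>A\<^esub> (z \<otimes>\<^bsub>A\<^esub> y)"
          using x y zc by (auto simp: m_ac)
        then show ?thesis
          using R z x y K(5)[of x "z \<otimes>\<^bsub>A\<^esub> y"] K(6)[of "z \<otimes>\<^bsub>A\<^esub> x" y] by auto
      qed
      with x y show "x \<otimes>\<^bsub>A\<^esub> y \<in> ?R" by simp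
    qed
    show "\<forall>x\<in>carrier A. \<forall>n::nat. x [^]\<^bsub>A\<^esub> n \<in> ?R \<longrightarrow> x \<in> ?R"
      using rad by blast
  qed
qed

lemma frame_Rad:
  assumes "preordered_semiring A"
  shows "frame (Rad A)"
proof -
  interpret preordered_semiring A by fact
  interpret R: complete_lattice "Rad A" by (rule complete_lattice_Rad) fact
  have carr: "I \<in> carrier (Rad A) \<longleftrightarrow> radical_ideal A I" for I
    by (simp add: Rad_def)
  have le: "I \<sqsubseteq>\<^bsub>Rad A\<^esub> J \<longleftrightarrow> I \<subseteq> J" for I J
    by (simp add: Rad_def)
  show ?thesis
  proof
    fix I S assume I: "I \<in> carrier (Rad A)" and S: "S \<subseteq> carrier (Rad A)"
    let ?J = "\<Squnion>\<^bsub>Rad A\<^esub>S" and ?T = "(\<lambda>J. I \<sqinter>\<^bsub>Rad A\<^esub> J) ` S"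
    let ?K = "\<Squnion>\<^bsub>Rad A\<^esub>?T"
    have T: "?T \<subseteq> carrier (Rad A)" using I S by auto
    have J: "radical_ideal A ?J" and K: "radical_ideal A ?K" and rI: "radical_ideal A I"
      using S T I R.sup_closed by (auto simp flip: carr)
    have IA: "I \<subseteq> carrier A" and JA: "?J \<subseteq> carrier A"
      using rI J by (auto dest!: radical_idealD(1) semiring_idealD(1))
    let ?Q = "{y \<in> carrier A. \<forall>x\<in>I. x \<otimes>\<^bsub>A\<^esub> y \<in> ?K}"
    have Q: "?Q \<in> carrier (Rad A)"
      unfolding carr using assms IA K by (rule radical_ideal_residual)
    have "?J \<sqsubseteq>\<^bsub>Rad A\<^esub> ?Q"
    proof (rule R.sup_least[OF S Q])
      fix L assume L: "L \<in> S"
      have rL: "radical_ideal A L" using L S carr by blast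
      have "I \<inter> L \<subseteq> ?K"
        using R.sup_upper[OF T imageI[OF L]] meet_Rad[OF assms rI rL]
        by (simp add: le)
      moreover have "x \<otimes>\<^bsub>A\<^esub> y \<in> I \<inter> L" if "x \<in> I" "y \<in> L" for x y
        using that semiring_idealD(1,5)[OF radical_idealD(1)[OF rI]]
          semiring_idealD(1,5)[OF radical_idealD(1)[OF rL]] by blast
      ultimately show "L \<sqsubseteq>\<^bsub>Rad A\<^esub> ?Q"
        using semiring_idealD(1)[OF radical_idealD(1)[OF rL]] unfolding le by blast
    qed
    then have JQ: "?J \<subseteq> ?Q" by (simp add: le)
    have "z \<in> ?K" if z: "z \<in> I" "z \<in> ?J" for z
    proof -
      have zc: "z \<in> carrier A" using z IA by blast
      have "z \<otimes>\<^bsub>A\<^esub> z \<in> ?K" using z JQ by blast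
      then have "z [^]\<^bsub>A\<^esub> (2::nat) \<in> ?K" using zc by (simp add: numeral_2_eq_2)
      then show ?thesis using zc radical_idealD(2)[OF K] by blast
    qed
    then have "I \<inter> ?J \<subseteq> ?K" by blast
    moreover have "?K \<subseteq> I \<inter> ?J"
    proof -
      have "?K \<sqsubseteq>\<^bsub>Rad A\<^esub> I \<sqinter>\<^bsub>Rad A\<^esub> ?J"
      proof (rule R.sup_least[OF T])
        show "I \<sqinter>\<^bsub>Rad A\<^esub> ?J \<in> carrier (Rad A)"
          using I S by simp
      next
        fix M assume "M \<in> ?T"
        then obtain L where L: "L \<in> S" "M = I \<sqinter>\<^bsub>Rad A\<^esub> L" by blast
        have rL: "radical_ideal A L" using L S carr by blast
        show "M \<sqsubseteq>\<^bsub>Rad A\<^esub> I \<sqinter>\<^bsub>Rad A\<^esub> ?J"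
          using R.sup_upper[OF S L(1)]
          by (auto simp: L(2) le meet_Rad[OF assms rI rL] meet_Rad[OF assms rI J])
      qed
      then show ?thesis by (simp add: le meet_Rad[OF assms rI J])
    qed
    ultimately show "I \<sqinter>\<^bsub>Rad A\<^esub> ?J = ?K"
      unfolding meet_Rad[OF assms rI J] by (rule equalityI)
  qed
qed

lemma frame_two: "frame two_frame"
proof -
  interpret P: partial_order two_frame
    by unfold_locales (auto simp: two_frame_def)
  have lub: "least two_frame (Sup S) (Upper two_frame S)" for S
    by (auto simp: least_def Upper_def two_frame_def)
  have glb: "greatest two_frame (Inf S) (Lower two_frame S)" for S
    by (auto simp: greatest_def Lower_def two_frame_def) (metis (full_types))
  interpret complete_lattice two_frame
    by (rule P.complete_latticeI) (use lub glb in blast)+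
  have sup: "\<Squnion>\<^bsub>two_frame\<^esub>S = Sup S" for S
    unfolding sup_def by (rule some_equality, rule lub) (use lub[of S] in \<open>auto simp: least_def two_frame_def\<close>)
  have inf: "\<Sqinter>\<^bsub>two_frame\<^esub>S = Inf S" for S
    unfolding inf_def by (rule some_equality, rule glb) (use glb[of S] in \<open>auto simp: greatest_def two_frame_def\<close>)
  show ?thesis
    by unfold_locales (auto simp: sup meet_def inf)
qed

end

(* A frame homomorphism p on Rad(A) preserves joins and every radical ideal J is the join of the
   radical ideals generated by its elements, so p J holds iff p holds at the closure of some x in J.
   Hence p is determined by its values on principal radical ideals, and f \<mapsto> (J \<mapsto> \<exists>x\<in>J. f x) inverts
   precomposition with the closure; it preserves joins because the zero set of f is a prime, hence
   radical, ideal.  Both maps are continuous since the Sierpinski space makes existential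
   quantification correspond to a union of open sets. *)

theory Submission
  imports Defs
begin

section \<open>Maps into the Sierpinski space; joins, meets and top of the two-element frame\<close>

lemma continuous_map_sierpinski:
  "continuous_map X sierpinski f \<longleftrightarrow> openin X {x \<in> topspace X. f x}"
  by (simp add: continuous_map_def openin_sierpinski)

lemma complete_lattice_two: "complete_lattice two_frame"
  using frame_two by (rule frame.axioms)

lemma sup_two: "\<Squnion>\<^bsub>two_frame\<^esub>S \<longleftrightarrow> True \<in> S"
proof -
  interpret complete_lattice two_frame by (rule complete_lattice_two)
  have S: "S \<subseteq> carrier two_frame"
    by (simp add: two_frame_def)
  show ?thesis
  proof
    assume "\<Squnion>\<^bsub>two_frame\<^esub>S"
    \<comment> \<open>The truth value \<open>True \<in> S\<close> is itself an upper bound of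
      \<open>S\<close>, so leastness of the join applies to it.\<close>
    moreover have "\<Squnion>\<^bsub>two_frame\<^esub>S \<sqsubseteq>\<^bsub>two_frame\<^esub> (True \<in> S)"
      by (rule sup_least[OF S]) (auto simp: two_frame_def le_bool_def)
    ultimately show "True \<in> S"
      by (simp add: two_frame_def)
  next
    assume "True \<in> S"
    from sup_upper[OF S this] show "\<Squnion>\<^bsub>two_frame\<^esub>S"
      by (simp add: two_frame_def)
  qed
qed

lemma meet_two: "a \<sqinter>\<^bsub>two_frame\<^esub> b \<longleftrightarrow> a \<and> b"
proof -
  interpret complete_lattice two_frame by (rule complete_lattice_two)
  have c: "x \<in> carrier two_frame" for x
    by (simp add: two_frame_def)
  have "(a \<and> b) \<sqsubseteq>\<^bsub>two_frame\<^esub> a \<sqinter>\<^bsub>two_frame\<^esub> b"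
    by (rule meet_le[OF _ _ c c c]) (simp_all add: two_frame_def le_bool_def)
  moreover have "a \<sqinter>\<^bsub>two_frame\<^esub> b \<sqsubseteq>\<^bsub>two_frame\<^esub> a" "a \<sqinter>\<^bsub>two_frame\<^esub> b \<sqsubseteq>\<^bsub>two_frame\<^esub> b"
    by (rule meet_left[OF c c], rule meet_right[OF c c])
  ultimately show ?thesis
    by (auto simp: two_frame_def le_bool_def)
qed

lemma top_two: "\<top>\<^bsub>two_frame\<^esub> \<longleftrightarrow> True"
proof -
  interpret complete_lattice two_frame by (rule complete_lattice_two)
  have "True \<sqsubseteq>\<^bsub>two_frame\<^esub> \<top>\<^bsub>two_frame\<^esub>"
    by (rule top_higher) (simp add: two_frame_def)
  then show ?thesis
    by (simp add: two_frame_def)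
qed

section \<open>Joins, top and points of the frame of radical ideals\<close>

lemma carrier_Rad: "carrier (Rad A) = {I. radical_ideal A I}"
  by (simp add: Rad_def)

lemma radical_ideal_subset_carrier: "radical_ideal A I \<Longrightarrow> I \<subseteq> carrier A"
  by (rule semiring_idealD(1)[OF radical_idealD(1)])

context preordered_semiring
begin

lemma radical_ideal_Sup:
  assumes "\<forall>J\<in>S. radical_ideal A J"
  shows "radical_ideal A (\<Squnion>\<^bsub>Rad A\<^esub>S)"
proof -
  interpret R: complete_lattice "Rad A"
    by (rule complete_lattice_Rad[OF preordered_semiring_axioms])
  have "S \<subseteq> carrier (Rad A)"
    using assms by (auto simp: carrier_Rad)
  then show ?thesis
    using R.sup_closed[of S] by (simp add: carrier_Rad)
qed

text \<open>Joins in \<open>Rad A\<close> are never computed as sets below; they are handled through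
  this universal property.\<close>

lemma Sup_Rad_subset_iff:
  assumes "\<forall>J\<in>S. radical_ideal A J" "radical_ideal A K"
  shows "\<Squnion>\<^bsub>Rad A\<^esub>S \<subseteq> K \<longleftrightarrow> (\<forall>J\<in>S. J \<subseteq> K)"
proof -
  interpret R: complete_lattice "Rad A"
    by (rule complete_lattice_Rad[OF preordered_semiring_axioms])
  have S: "S \<subseteq> carrier (Rad A)" and K: "K \<in> carrier (Rad A)"
    using assms by (auto simp: carrier_Rad)
  show ?thesis
    using R.sup_least[OF S K] R.sup_upper[OF S] by (auto simp: Rad_def)
qed

lemma radical_ideal_carrier: "radical_ideal A (carrier A)"
  by (auto simp: radical_ideal_def semiring_ideal_def)

lemma top_Rad: "\<top>\<^bsub>Rad A\<^esub> = carrier A"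
proof -
  interpret R: complete_lattice "Rad A"
    by (rule complete_lattice_Rad[OF preordered_semiring_axioms])
  have "carrier A \<sqsubseteq>\<^bsub>Rad A\<^esub> \<top>\<^bsub>Rad A\<^esub>"
    by (rule R.top_higher) (simp add: carrier_Rad radical_ideal_carrier)
  moreover have "\<top>\<^bsub>Rad A\<^esub> \<subseteq> carrier A"
    using R.top_closed by (intro radical_ideal_subset_carrier) (simp add: carrier_Rad)
  ultimately show ?thesis
    by (auto simp: Rad_def)
qed

text \<open>Turns the lattice conditions into logic: in \<open>two_frame\<close> a join is an
  existential and a meet a conjunction, while meets in \<open>Rad A\<close> are intersections. The
  case \<open>S = {}\<close> says that \<open>p\<close> is false at the bottom element.\<close>

lemma frame_hom_Rad_two_iff:
  "frame_hom (Rad A) two_frame p \<longleftrightarrow>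
     p \<in> extensional {I. radical_ideal A I} \<and>
     (\<forall>S. (\<forall>J\<in>S. radical_ideal A J) \<longrightarrow> (p (\<Squnion>\<^bsub>Rad A\<^esub>S) \<longleftrightarrow> (\<exists>J\<in>S. p J))) \<and>
     (\<forall>I J. radical_ideal A I \<longrightarrow> radical_ideal A J \<longrightarrow> (p (I \<inter> J) \<longleftrightarrow> p I \<and> p J)) \<and>
     p (carrier A)"
proof -
  have "lattice (Rad A)" "lattice two_frame"
    using complete_lattice.axioms(1) complete_lattice_Rad[OF preordered_semiring_axioms]
      complete_lattice_two complete_lattice_lattice by blast+
  moreover have "p \<in> carrier (Rad A) \<rightarrow>\<^sub>E carrier two_frame \<longleftrightarrow> p \<in> extensional {I. radical_ideal A I}"
    by (simp add: carrier_Rad PiE_def two_frame_def)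
  moreover have "True \<in> p ` S \<longleftrightarrow> (\<exists>J\<in>S. p J)" for S
    by auto
  ultimately show ?thesis
    using frame_Rad[OF preordered_semiring_axioms] frame_two
      complete_lattice_Rad[OF preordered_semiring_axioms] complete_lattice_two
    by (simp add: frame_hom_def sup_pres_def meet_pres_def sup_two meet_two top_two top_Rad
        carrier_Rad subset_eq meet_Rad[OF preordered_semiring_axioms])
qed

section \<open>Principal radical ideals\<close>

lemma radical_ideal_radical_closure:
  assumes "x \<in> carrier A"
  shows "radical_ideal A (radical_closure A x)"
proof -
  let ?S = "{I. radical_ideal A I \<and> x \<in> I}"
  have "carrier A \<inter> \<Inter>?S \<in> carrier (Rad A)"
    using greatest_Lower_Rad[OF preordered_semiring_axioms, of ?S]
    by (auto simp: greatest_def carrier_Rad Lower_def)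
  \<comment> \<open>As \<open>x\<close> lies in the carrier, \<open>carrier A\<close> is one of the
    ideals intersected, so the extra factor is absorbed.\<close>
  moreover have "carrier A \<inter> \<Inter>?S = radical_closure A x"
    using assms radical_ideal_carrier by (auto simp: radical_closure_def)
  ultimately show ?thesis
    by (simp add: carrier_Rad)
qed

text \<open>The closure is the least radical ideal containing \<open>x\<close>. For \<open>x\<close>
  outside the carrier it is the empty intersection \<open>UNIV\<close>, and both sides are
  false.\<close>

lemma radical_closure_subset_iff:
  assumes "radical_ideal A J"
  shows "radical_closure A x \<subseteq> J \<longleftrightarrow> x \<in> J"
  using assms by (auto simp: radical_closure_def)

lemma in_radical_closure: "x \<in> radical_closure A x"
  by (simp add: radical_closure_def)

lemma radical_closure_one: "radical_closure A \<one> = carrier A"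
proof
  have R: "radical_ideal A (radical_closure A \<one>)"
    by (simp add: radical_ideal_radical_closure)
  then show "radical_closure A \<one> \<subseteq> carrier A"
    by (rule radical_ideal_subset_carrier)
  show "carrier A \<subseteq> radical_closure A \<one>"
  proof
    fix x assume x: "x \<in> carrier A"
    then have "\<one> \<otimes> x \<in> radical_closure A \<one>"
      using semiring_idealD(5)[OF radical_idealD(1)[OF R]] in_radical_closure by blast
    with x show "x \<in> radical_closure A \<one>" by simp
  qed
qed

text \<open>The hard inclusion applies \<open>radical_ideal_residual\<close> twice, extending "the
  product lies in \<open>?K\<close>" from the generators to all of \<open>?X\<close> and
  \<open>?Y\<close>, one factor at a time.\<close>

lemma radical_closure_mult:
  assumes x: "x \<in> carrier A" and y: "y \<in> carrier A"
  shows "radical_closure A (x \<otimes> y) = radical_closure A x \<inter> radical_closure A y" (is "?K = ?X \<inter> ?Y")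
proof
  have K: "radical_ideal A ?K" and X: "radical_ideal A ?X" and Y: "radical_ideal A ?Y"
    using x y by (simp_all add: radical_ideal_radical_closure)
  have YA: "?Y \<subseteq> carrier A"
    using Y by (rule radical_ideal_subset_carrier)
  have "x \<otimes> y \<in> ?X" "x \<otimes> y \<in> ?Y"
    using x y in_radical_closure
      semiring_idealD(5)[OF radical_idealD(1)[OF X]] semiring_idealD(5)[OF radical_idealD(1)[OF Y]]
    by blast+
  then show "?K \<subseteq> ?X \<inter> ?Y"
    using X Y by (simp add: radical_closure_subset_iff)
  \<comment> \<open>This residual of \<open>?K\<close> by \<open>x\<close> is a radical ideal
    containing \<open>y\<close>, hence contains \<open>?Y\<close>.\<close>
  have "?Y \<subseteq> {z \<in> carrier A. \<forall>a\<in>{x}. a \<otimes> z \<in> ?K}"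
    using radical_ideal_residual[OF preordered_semiring_axioms _ K, of "{x}"] x y
    by (subst radical_closure_subset_iff) (auto intro: in_radical_closure)
  \<comment> \<open>The residual of \<open>?K\<close> by all of \<open>?Y\<close> now contains
    \<open>x\<close>, hence \<open>?X\<close>.\<close>
  then have "?X \<subseteq> {w \<in> carrier A. \<forall>z\<in>?Y. z \<otimes> w \<in> ?K}"
    using radical_ideal_residual[OF preordered_semiring_axioms YA K] x YA
    by (subst radical_closure_subset_iff) (auto simp: m_comm subset_iff)
  \<comment> \<open>With both factors equal to \<open>z\<close>, the square of \<open>z\<close> lies
    in \<open>?K\<close>, and radicality gives \<open>z\<close> itself.\<close>
  then have "z [^] (2::nat) \<in> ?K" "z \<in> carrier A" if "z \<in> ?X \<inter> ?Y" for z
    using that by (auto simp: numeral_2_eq_2 subset_iff)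
  then show "?X \<inter> ?Y \<subseteq> ?K"
    using radical_idealD(2)[OF K] by blast
qed

section \<open>From points of the frame to morphisms into the two-element chain, and back\<close>

lemma subadditive_morphism_radical_closure:
  assumes "frame_hom (Rad A) two_frame p"
  shows "subadditive_morphism A two_semiring (\<lambda>x\<in>carrier A. p (radical_closure A x))"
proof -
  from assms have
    sup: "\<And>S. \<forall>J\<in>S. radical_ideal A J \<Longrightarrow> p (\<Squnion>\<^bsub>Rad A\<^esub>S) \<longleftrightarrow> (\<exists>J\<in>S. p J)" and
    meet: "\<And>I J. \<lbrakk>radical_ideal A I; radical_ideal A J\<rbrakk> \<Longrightarrow> p (I \<inter> J) \<longleftrightarrow> p I \<and> p J" and
    top: "p (carrier A)"
    by (simp_all add: frame_hom_Rad_two_iff)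
  note rc = radical_ideal_radical_closure
  \<comment> \<open>Monotonicity comes from preservation of meets, since
    \<open>I \<inter> J = I\<close>.\<close>
  have mono: "p J" if "radical_ideal A I" "radical_ideal A J" "I \<subseteq> J" "p I" for I J
    using meet[OF that(1,2)] that(3,4) by (simp add: Int_absorb2)
  have le: "p (radical_closure A y)"
    if "x \<in> carrier A" "y \<in> carrier A" "x \<preceq> y" "p (radical_closure A x)" for x y
  proof (rule mono[OF rc rc _ that(4)])
    have "x \<in> radical_closure A y"
      using that(1-3) semiring_idealD(2)[OF radical_idealD(1)[OF rc[OF that(2)]]]
        in_radical_closure by blast
    then show "radical_closure A x \<subseteq> radical_closure A y"
      using rc[OF that(2)] by (simp add: radical_closure_subset_iff)
  qed (use that in auto)
  have zero: "\<not> p (radical_closure A \<zero>)"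
  proof
    assume "p (radical_closure A \<zero>)"
    \<comment> \<open>The empty join is a radical ideal, so it contains \<open>\<zero>\<close> and
      its closure; but \<open>p\<close> is false there, being an existential over the empty
      family.\<close>
    moreover have B: "radical_ideal A (\<Squnion>\<^bsub>Rad A\<^esub>{})"
      by (rule radical_ideal_Sup) simp
    moreover have "radical_closure A \<zero> \<subseteq> \<Squnion>\<^bsub>Rad A\<^esub>{}"
      using B semiring_idealD(3)[OF radical_idealD(1)[OF B]] by (simp add: radical_closure_subset_iff)
    ultimately have "p (\<Squnion>\<^bsub>Rad A\<^esub>{})"
      using mono[OF rc[OF zero_closed]] by blast
    then show False
      by (simp add: sup)
  qed
  have add: "p (radical_closure A x) \<or> p (radical_closure A y)"
    if x: "x \<in> carrier A" and y: "y \<in> carrier A" and p: "p (radical_closure A (x \<oplus> y))" for x y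
  proof -
    \<comment> \<open>The join of the two closures contains \<open>x\<close> and \<open>y\<close>,
      hence \<open>x \<oplus> y\<close> and its closure; \<open>p\<close> turns this join into the
      required disjunction.\<close>
    let ?S = "{radical_closure A x, radical_closure A y}"
    have S: "\<forall>J\<in>?S. radical_ideal A J"
      using x y by (simp add: rc)
    have K: "radical_ideal A (\<Squnion>\<^bsub>Rad A\<^esub>?S)"
      by (rule radical_ideal_Sup[OF S])
    have "x \<in> \<Squnion>\<^bsub>Rad A\<^esub>?S" "y \<in> \<Squnion>\<^bsub>Rad A\<^esub>?S"
      using Sup_Rad_subset_iff[OF S K] by (auto simp: radical_closure_subset_iff[OF K])
    then have "x \<oplus> y \<in> \<Squnion>\<^bsub>Rad A\<^esub>?S"
      using semiring_idealD(4)[OF radical_idealD(1)[OF K]] by blast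
    then have "radical_closure A (x \<oplus> y) \<subseteq> \<Squnion>\<^bsub>Rad A\<^esub>?S"
      using K by (simp add: radical_closure_subset_iff)
    then have "p (\<Squnion>\<^bsub>Rad A\<^esub>?S)"
      using p x y by (intro mono[OF rc[OF a_closed] K])
    then show ?thesis
      using sup[OF S] by simp
  qed
  show ?thesis
    unfolding subadditive_morphism_two_iff
    using le zero add by (auto simp: radical_closure_mult meet rc radical_closure_one top)
qed

text \<open>Prime ideals are radical.\<close>

lemma radical_ideal_zero_set:
  assumes "subadditive_morphism A two_semiring f"
  shows "radical_ideal A {x \<in> carrier A. \<not> f x}"
proof -
  have "(\<lambda>f. {x \<in> carrier A. \<not> f x}) ` topspace (Spec A) = {I. prime_ideal A I}"
    using Spec_prime_ideals[OF preordered_semiring_axioms] by (rule bij_betw_imp_surj_on)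
  then have "prime_ideal A {x \<in> carrier A. \<not> f x}"
    using assms by (auto simp: topspace_Spec)
  \<comment> \<open>Contrapositive of radicality. The case \<open>n = 0\<close> is
    \<open>f \<one>\<close>, the properness of the prime.\<close>
  moreover have "f (x [^] n)" if "x \<in> carrier A" "f x" for x and n :: nat
    using that assms by (induction n) (simp_all add: subadditive_morphism_two_iff)
  ultimately show ?thesis
    by (auto simp: radical_ideal_def prime_ideal_def)
qed

lemma frame_hom_of_subadditive_morphism:
  assumes "subadditive_morphism A two_semiring f"
  shows "frame_hom (Rad A) two_frame (\<lambda>J\<in>{I. radical_ideal A I}. \<exists>x\<in>J. f x)"
proof -
  let ?N = "{x \<in> carrier A. \<not> f x}"
  have N: "radical_ideal A ?N"
    using assms by (rule radical_ideal_zero_set)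
  \<comment> \<open>The candidate point is true exactly at the ideals not below \<open>?N\<close>,
    so preservation of joins reduces to \<open>Sup_Rad_subset_iff\<close> with
    \<open>K = ?N\<close>.\<close>
  have ker: "(\<exists>x\<in>J. f x) \<longleftrightarrow> \<not> J \<subseteq> ?N" if "radical_ideal A J" for J
    using radical_ideal_subset_carrier[OF that] by auto
  from assms have mult: "\<And>x y. \<lbrakk>x \<in> carrier A; y \<in> carrier A\<rbrakk> \<Longrightarrow> f (x \<otimes> y) \<longleftrightarrow> f x \<and> f y"
    and one: "f \<one>"
    by (simp_all add: subadditive_morphism_two_iff)
  have sup: "(\<exists>x\<in>\<Squnion>\<^bsub>Rad A\<^esub>S. f x) \<longleftrightarrow> (\<exists>J\<in>S. \<exists>x\<in>J. f x)" if S: "\<forall>J\<in>S. radical_ideal A J" for S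
    using ker[OF radical_ideal_Sup[OF S]] Sup_Rad_subset_iff[OF S N] ker S by blast
  \<comment> \<open>The witness is the product of the two given witnesses: it lies in both ideals,
    and \<open>f\<close> is multiplicative.\<close>
  have meet: "\<exists>x\<in>I \<inter> J. f x"
    if I: "radical_ideal A I" and J: "radical_ideal A J" and x: "x \<in> I" "f x" and y: "y \<in> J" "f y"
    for I J x y
  proof
    have xy: "x \<in> carrier A" "y \<in> carrier A"
      using radical_ideal_subset_carrier I J x(1) y(1) by blast+
    then show "f (x \<otimes> y)"
      using x y by (simp add: mult)
    show "x \<otimes> y \<in> I \<inter> J"
      using xy x(1) y(1) semiring_idealD(5)[OF radical_idealD(1)[OF I]]
        semiring_idealD(5)[OF radical_idealD(1)[OF J]] by blast
  qed
  \<comment> \<open>The candidate point is restricted to radical ideals, so its value at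
    \<open>I \<inter> J\<close> is the existential only once this set is known to be
    radical.\<close>
  have inter: "radical_ideal A (I \<inter> J)" if "radical_ideal A I" "radical_ideal A J" for I J
  proof -
    have "greatest (Rad A) (carrier A \<inter> \<Inter>{I, J}) (Lower (Rad A) {I, J})"
      using that by (intro greatest_Lower_Rad[OF preordered_semiring_axioms]) (simp add: carrier_Rad)
    moreover have "carrier A \<inter> \<Inter>{I, J} = I \<inter> J"
      using radical_ideal_subset_carrier[OF that(1)] by auto
    ultimately show ?thesis
      by (simp add: greatest_def Lower_def carrier_Rad)
  qed
  show ?thesis
    unfolding frame_hom_Rad_two_iff
  proof (intro conjI allI impI)
    show "(\<lambda>J\<in>{I. radical_ideal A I}. \<exists>x\<in>J. f x) (\<Squnion>\<^bsub>Rad A\<^esub>S) \<longleftrightarrow>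
        (\<exists>J\<in>S. (\<lambda>J\<in>{I. radical_ideal A I}. \<exists>x\<in>J. f x) J)" if S: "\<forall>J\<in>S. radical_ideal A J" for S
      using sup[OF S] S by (simp add: radical_ideal_Sup)
    show "(\<lambda>J\<in>{I. radical_ideal A I}. \<exists>x\<in>J. f x) (I \<inter> J) \<longleftrightarrow>
        (\<lambda>J\<in>{I. radical_ideal A I}. \<exists>x\<in>J. f x) I \<and> (\<lambda>J\<in>{I. radical_ideal A I}. \<exists>x\<in>J. f x) J"
      if "radical_ideal A I" "radical_ideal A J" for I J
      using meet[OF that] inter[OF that] that by auto
    show "(\<lambda>J\<in>{I. radical_ideal A I}. \<exists>x\<in>J. f x) (carrier A)"
      using one by (auto simp: radical_ideal_carrier)
  qed simp
qed

section \<open>The two maps are mutually inverse\<close>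

lemma Sup_radical_closure:
  assumes J: "radical_ideal A J"
  shows "\<Squnion>\<^bsub>Rad A\<^esub>(radical_closure A ` J) = J"
proof
  have S: "\<forall>I\<in>radical_closure A ` J. radical_ideal A I"
    using radical_ideal_subset_carrier[OF J] by (auto intro: radical_ideal_radical_closure)
  show "\<Squnion>\<^bsub>Rad A\<^esub>(radical_closure A ` J) \<subseteq> J"
    using Sup_Rad_subset_iff[OF S J] by (simp add: radical_closure_subset_iff[OF J])
  \<comment> \<open>Each element of \<open>J\<close> lies in its own closure, which is one of the
    ideals joined.\<close>
  show "J \<subseteq> \<Squnion>\<^bsub>Rad A\<^esub>(radical_closure A ` J)"
    using Sup_Rad_subset_iff[OF S radical_ideal_Sup[OF S]] in_radical_closure by blast
qed

text \<open>Applies \<open>p\<close> to the decomposition of \<open>J\<close> into principal radical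
  ideals; this is the round trip starting at a point \<open>p\<close>.\<close>

lemma frame_hom_Rad_two_eq_Ex:
  assumes "frame_hom (Rad A) two_frame p" "radical_ideal A J"
  shows "p J \<longleftrightarrow> (\<exists>x\<in>J. p (radical_closure A x))"
proof -
  have "\<forall>I\<in>radical_closure A ` J. radical_ideal A I"
    using radical_ideal_subset_carrier[OF assms(2)] by (auto intro: radical_ideal_radical_closure)
  then have "p (\<Squnion>\<^bsub>Rad A\<^esub>(radical_closure A ` J)) \<longleftrightarrow> (\<exists>I\<in>radical_closure A ` J. p I)"
    using assms(1) unfolding frame_hom_Rad_two_iff by blast
  then show ?thesis
    by (simp add: Sup_radical_closure[OF assms(2)])
qed

text \<open>The zero set of \<open>f\<close> is radical, so it contains the closure of
  \<open>x\<close> as soon as it contains \<open>x\<close>. This is the round trip starting at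
  \<open>f\<close>.\<close>

lemma subadditive_morphism_two_eq_Ex:
  assumes "subadditive_morphism A two_semiring f" "x \<in> carrier A"
  shows "(\<exists>y\<in>radical_closure A x. f y) \<longleftrightarrow> f x"
proof -
  have "radical_closure A x \<subseteq> {y \<in> carrier A. \<not> f y} \<longleftrightarrow> \<not> f x"
    using assms(2) by (simp add: radical_closure_subset_iff[OF radical_ideal_zero_set[OF assms(1)]])
  then show ?thesis
    using radical_ideal_subset_carrier[OF radical_ideal_radical_closure[OF assms(2)]] by blast
qed

section \<open>Continuity in both directions\<close>

lemma continuous_map_pt_Spec:
  "continuous_map (pt (Rad A)) (Spec A) (\<lambda>p. \<lambda>x\<in>carrier A. p (radical_closure A x))"
proof -
  \<comment> \<open>The coordinate at \<open>x\<close> is the product projection at the index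
    \<open>radical_closure A x\<close>.\<close>
  have "continuous_map (pt (Rad A)) sierpinski (\<lambda>p. p (radical_closure A x))"
    if "x \<in> carrier A" for x
    unfolding pt_def using that
    by (intro continuous_map_from_subtopology continuous_map_product_projection)
      (simp add: carrier_Rad radical_ideal_radical_closure)
  then show ?thesis
    unfolding Spec_def
    by (auto simp: continuous_map_in_subtopology continuous_map_componentwise topspace_pt
        subadditive_morphism_radical_closure)
qed

lemma continuous_map_Spec_pt:
  "continuous_map (Spec A) (pt (Rad A)) (\<lambda>f. \<lambda>J\<in>{I. radical_ideal A I}. \<exists>x\<in>J. f x)"
proof -
  have "continuous_map (Spec A) sierpinski (\<lambda>f. \<exists>x\<in>J. f x)" if "radical_ideal A J" for J
  proof -
    have "openin (Spec A) {f \<in> topspace (Spec A). f x}" if "x \<in> carrier A" for x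
      using that unfolding continuous_map_sierpinski[symmetric] Spec_def
      by (intro continuous_map_from_subtopology continuous_map_product_projection)
    \<comment> \<open>The set where the coordinate at \<open>J\<close> is true is the union of the
      basic open sets D_x over the elements \<open>x\<close> of \<open>J\<close>.\<close>
    then have "openin (Spec A) (\<Union>x\<in>J. {f \<in> topspace (Spec A). f x})"
      using radical_ideal_subset_carrier[OF that] by blast
    also have "(\<Union>x\<in>J. {f \<in> topspace (Spec A). f x}) = {f \<in> topspace (Spec A). \<exists>x\<in>J. f x}"
      by blast
    finally show ?thesis
      by (simp add: continuous_map_sierpinski)
  qed
  then show ?thesis
    unfolding pt_def
    by (auto simp: continuous_map_in_subtopology continuous_map_componentwise topspace_Spec
        carrier_Rad frame_hom_of_subadditive_morphism)
qed

end

theorem proposition6p1: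
  fixes A :: "('a, 'b) osemiring_scheme"
  assumes "preordered_semiring A"
  shows "homeomorphic_map (pt (Rad A)) (Spec A) (\<lambda>p. \<lambda>x\<in>carrier A. p (radical_closure A x))"
proof -
  interpret preordered_semiring A by fact
  let ?to = "\<lambda>p. \<lambda>x\<in>carrier A. p (radical_closure A x)"
  let ?from = "\<lambda>f. \<lambda>J\<in>{I. radical_ideal A I}. \<exists>x\<in>J. f x"
  have "?from (?to p) = p" if p: "frame_hom (Rad A) two_frame p" for p
  proof (rule extensionalityI)
    show "p \<in> extensional {I. radical_ideal A I}"
      using p by (simp add: frame_hom_Rad_two_iff)
    \<comment> \<open>Since \<open>J\<close> lies in the carrier, \<open>?to p\<close> is evaluated
      only where the restricted function takes its proper value.\<close>
    show "?from (?to p) J = p J" if "J \<in> {I. radical_ideal A I}" for J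
      using that radical_ideal_subset_carrier[of A J]
      by (auto simp: frame_hom_Rad_two_eq_Ex[OF p])
  qed simp
  moreover have "?to (?from f) = f" if f: "subadditive_morphism A two_semiring f" for f
  proof (rule extensionalityI)
    show "f \<in> extensional (carrier A)"
      using f by (simp add: subadditive_morphism_two_iff)
    show "?to (?from f) x = f x" if "x \<in> carrier A" for x
      using that by (simp add: radical_ideal_radical_closure subadditive_morphism_two_eq_Ex[OF f])
  qed simp
  ultimately have "homeomorphic_maps (pt (Rad A)) (Spec A) ?to ?from"
    by (simp add: homeomorphic_maps_def continuous_map_pt_Spec continuous_map_Spec_pt
        topspace_pt topspace_Spec)
  then show ?thesis
    by (auto simp: homeomorphic_map_maps)
qed

end
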